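(* Let $m$ be a square-free positive integer and let $A\subset\mathbb{Z}_m$ satisfy $(A-A)\cap R_m=\{0\}$. Then $$|A|\leq m^{1/2}q^{-1/2}(10\,\omega(m))^{2\omega(m)},$$ where $q$ denotes the least prime divisor of $m$ of the form $4k+3$ if $\omega_3(m)$ is odd, and $q=1$ otherwise.
   Context: $\mathbb{Z}_m$ is the ring of integers modulo $m$; $R_m=\{a^2 : a\in\mathbb{Z}_m\}$ is the set of all squares in $\mathbb{Z}_m$ (including $0$ and squares that are not units); $A-A=\{a-b : a,b\in A\}$. $\omega(m)$ is the number of distinct prime divisors of $m$, and $\omega_3(m)$ is the number of distinct prime divisors of $m$ of the form $4k+3$. For $m=1$ the expression $0^0$ is read as $1$. *)

theory Defs
  imports
    Complex_Main
    "HOL-Computational_Algebra.Computational_Algebra"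
    "HOL-Number_Theory.Residues"
begin

(* Z_m is residue_ring (int m), with carrier {0..m-1}. At m = 1 that record has carrier {0}
   but one = 1 outside the carrier, so squares are written as products: a [^] 2 would start
   from one. The zero, addition, subtraction and multiplication are the right ones there too. *)
definition ring_squares :: "('a, 'b) ring_scheme \<Rightarrow> 'a set" where
  "ring_squares R = {a \<otimes>\<^bsub>R\<^esub> a | a. a \<in> carrier R}"

definition difference_set :: "('a, 'b) ring_scheme \<Rightarrow> 'a set \<Rightarrow> 'a set" where
  "difference_set R A = {a \<ominus>\<^bsub>R\<^esub> b | a b. a \<in> A \<and> b \<in> A}"

definition omega :: "nat \<Rightarrow> nat" where
  "omega m = card {p. prime p \<and> p dvd m}"

definition omega3 :: "nat \<Rightarrow> nat" where
  "omega3 m = card {p. prime p \<and> p dvd m \<and> p mod 4 = 3}"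

(* The number q of the theorem. The Min is over a finite nonempty set: m > 0 and omega3 m is odd. *)
definition exceptional_factor :: "nat \<Rightarrow> nat" where
  "exceptional_factor m =
     (if odd (omega3 m) then Min {p. prime p \<and> p dvd m \<and> p mod 4 = 3} else 1)"

end

theory Submission
  imports Defs "HOL-Number_Theory.Euler_Criterion"
begin

text \<open>
  The proof is a Delsarte type linear programming bound. Suppose that a function \<open>f\<close> on the residues
  modulo \<open>m\<close> is \<open>1\<close> at \<open>0\<close>, is supported on squares, and has a Fourier transform with nonnegative real
  part. Counting \<open>f (a - b)\<close> over all pairs from \<open>A\<close> gives \<open>card A\<close>, because only \<open>a = b\<close> contributes. By
  Parseval the same count is at least the term of the zero frequency, which is \<open>(card A)\<^sup>2 / m\<close> times the
  transform of \<open>f\<close> at \<open>0\<close>. Hence \<open>card A\<close> is at most \<open>m\<close> divided by that value, and the task is to find \<open>f\<close>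
  whose transform is nonnegative and as large as possible at \<open>0\<close>.

  Let \<open>M\<close> be the set of the \<open>n\<close> primes dividing \<open>m\<close>. The squares modulo \<open>m\<close> split into faces: for each
  subset \<open>S\<close> of \<open>M\<close>, the residues that are nonzero squares modulo the primes in \<open>S\<close> and zero modulo the
  others. Take \<open>f\<close> of weight \<open>c S\<close> on the face \<open>S\<close> (half of that if \<open>S\<close> contains \<open>2\<close>). Its transform is the sum over \<open>S\<close> of \<open>c S\<close> times a
  product of local transforms, which are \<open>(p - 1) / 2\<close> at frequency zero and otherwise
  \<open>(G - 1) / 2\<close> for a quadratic Gauss sum \<open>G\<close>. For odd \<open>p\<close> and nonzero frequency this \<open>G\<close> has
  modulus \<open>sqrt p\<close>; it is real for \<open>p = 4k+1\<close> and imaginary for \<open>p = 4k+3\<close>. Thus a product of local transforms at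
  nonzero frequencies over a set \<open>T\<close> has real part at most the square root of the product of
  \<open>T\<close>, and smaller by a further factor \<open>sqrt q\<close> if \<open>T\<close> contains an odd number of primes \<open>4k+3\<close>, all of them
  at least \<open>q\<close> (\<open>Re_prod_bound\<close>).

  These sizes dictate \<open>c S = x ^ card S * g S / sqrt (\<Prod>S)\<close>, where \<open>g S\<close> is \<open>sqrt q\<close> for an odd number of primes
  \<open>4k+3\<close> in \<open>S\<close> and \<open>1\<close> otherwise. Since \<open>g\<close> is submultiplicative, at every frequency the terms without a
  definite sign are dominated by nonnegative ones once \<open>x = 1 / (2 * n)\<close>
  (\<open>sum_coefficient_nonneg\<close>). At frequency zero the full face \<open>S = M\<close> alone contributes
  about \<open>sqrt m * g M / (8 * n) ^ n\<close>, which gives \<open>card A \<le> sqrt m / g M * (8 * n) ^ n\<close>. With \<open>q\<close> the exceptional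
  factor, \<open>g M\<close> is \<open>sqrt q\<close> in both parities.
\<close>

section \<open>Additive characters modulo p\<close>

definition unity :: "nat \<Rightarrow> int \<Rightarrow> complex" where
  "unity p t = cis (2 * pi * (of_int t / real p))"

lemma unity_0 [simp]: "unity p 0 = 1"
  by (simp add: unity_def)

lemma unity_add: "unity p (s + t) = unity p s * unity p t"
  by (simp add: unity_def cis_mult add_divide_distrib ring_distribs)

lemma unity_minus: "unity p (- t) = cnj (unity p t)"
  by (simp add: unity_def cis_cnj)

lemma norm_unity [simp]: "norm (unity p t) = 1"
  by (simp add: unity_def)

lemma unity_eq_1_iff:
  assumes "p > 0"
  shows "unity p t = 1 \<longleftrightarrow> int p dvd t"
proof
  assume "int p dvd t"
  then obtain s where "t = int p * s" by blast
  then have "of_int t / real p = of_int s"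
    using assms by simp
  then show "unity p t = 1"
    unfolding unity_def by (simp add: cis_multiple_2pi)
next
  assume "unity p t = 1"
  then have "cos (2 * pi * (of_int t / real p)) = 1"
    by (simp add: unity_def complex_eq_iff)
  then obtain s :: int where "2 * pi * (of_int t / real p) = of_int s * 2 * pi"
    using cos_one_2pi_int by blast
  then have "(of_int t / real p) * (2 * pi) = of_int s * (2 * pi)" by (simp only: mult_ac)
  then have "of_int t / real p = of_int s" by (rule mult_right_cancel[THEN iffD1, rotated]) simp
  then have "(of_int t :: real) = of_int (s * int p)"
    using assms by (simp add: field_simps)
  then have "t = s * int p" by (rule of_int_eq_iff[THEN iffD1])
  then show "int p dvd t" by simp
qed

lemma unity_cong:
  assumes "p > 0" "[s = t] (mod int p)"
  shows "unity p s = unity p t"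
proof -
  have "unity p (s - t) = 1"
    using assms by (simp add: unity_eq_1_iff cong_iff_dvd_diff)
  then show ?thesis
    using unity_add[of p "s - t" t] by simp
qed

lemma sum_unity:
  assumes "p > 0"
  shows "(\<Sum>k\<in>{0..<int p}. unity p (k * t)) = (if int p dvd t then of_nat p else 0)"
proof (cases "int p dvd t")
  case True
  then have "unity p (k * t) = 1" for k
    using assms by (simp add: unity_eq_1_iff)
  then show ?thesis using True by simp
next
  case False
  let ?S = "\<Sum>k\<in>{0..<int p}. unity p (k * t)"
  have pow: "unity p (int k * t) = unity p t ^ k" for k
    by (induction k) (simp_all add: ring_distribs unity_add)
  have "?S = (\<Sum>k<p. unity p (int k * t))"
    by (rule sum.reindex_bij_witness[of _ int nat]) auto
  also have "\<dots> = (\<Sum>k<p. unity p t ^ k)" by (simp add: pow)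
  also have "\<dots> = (unity p t ^ p - 1) / (unity p t - 1)"
    using False assms by (intro geometric_sum) (simp add: unity_eq_1_iff)
  also have "unity p t ^ p = unity p (int p * t)" by (simp add: pow)
  also have "\<dots> = 1" using assms by (simp add: unity_eq_1_iff)
  finally show ?thesis using False by simp
qed

section \<open>Quadratic Gauss sums\<close>

lemma sum_periodic_shift:
  fixes F :: "int \<Rightarrow> 'a::comm_monoid_add"
  assumes "n > 0" and per: "\<And>x y. [x = y] (mod n) \<Longrightarrow> F x = F y"
  shows "(\<Sum>x\<in>{0..<n}. F (x + c)) = (\<Sum>x\<in>{0..<n}. F x)"
proof (rule sum.reindex_bij_witness[of _ "\<lambda>x. (x - c) mod n" "\<lambda>x. (x + c) mod n"])
  fix a assume a: "a \<in> {0..<n}"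
  show "((a + c) mod n - c) mod n = a"
    using a by (simp add: mod_diff_left_eq)
  show "((a - c) mod n + c) mod n = a"
    using a by (simp add: mod_add_left_eq)
  show "F ((a + c) mod n) = F (a + c)"
    by (rule per) simp
qed (use assms in auto)

lemma sum_periodic_scale:
  fixes F :: "int \<Rightarrow> 'a::comm_monoid_add"
  assumes "n > 0" and inverse: "[c * d = 1] (mod n)"
    and per: "\<And>x y. [x = y] (mod n) \<Longrightarrow> F x = F y"
  shows "(\<Sum>x\<in>{0..<n}. F (c * x)) = (\<Sum>x\<in>{0..<n}. F x)"
proof -
  have cancel: "(c * (d * a)) mod n = a" "(d * (c * a)) mod n = a" if "a \<in> {0..<n}" for a
  proof -
    have "[c * d * a = 1 * a] (mod n)" using inverse by (rule cong_scalar_right)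
    then show "(c * (d * a)) mod n = a" "(d * (c * a)) mod n = a"
      using that by (simp_all add: cong_def mult_ac)
  qed
  show ?thesis
  proof (rule sum.reindex_bij_witness[of _ "\<lambda>x. (d * x) mod n" "\<lambda>x. (c * x) mod n"])
    fix a assume a: "a \<in> {0..<n}"
    show "(d * (c * a mod n)) mod n = a" "(c * (d * a mod n)) mod n = a"
      using cancel[OF a] by (simp_all add: mod_mult_right_eq)
    show "F ((c * a) mod n) = F (c * a)"
      by (rule per) simp
  qed (use assms in auto)
qed

definition gauss_sum :: "nat \<Rightarrow> int \<Rightarrow> complex" where
  "gauss_sum p k = (\<Sum>x\<in>{0..<int p}. unity p (k * x\<^sup>2))"

text \<open>
  Expanding the square of the modulus gives phases \<open>k * (x\<^sup>2 - y\<^sup>2)\<close>. With \<open>x = d + y\<close> they become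
  \<open>k * d\<^sup>2 + 2 * k * d * y\<close>, linear in \<open>y\<close>, so orthogonality leaves only \<open>d = 0\<close>.
\<close>

lemma norm_gauss_sum:
  assumes p: "prime p" "odd p" and k: "\<not> int p dvd k"
  shows "cmod (gauss_sum p k) = sqrt (real p)"
proof -
  have pos: "p > 0" using p by (simp add: prime_gt_0_nat)
  let ?I = "{0..<int p}"
  have "gauss_sum p k * cnj (gauss_sum p k)
      = (\<Sum>y\<in>?I. \<Sum>x\<in>?I. unity p (k * x\<^sup>2 - k * y\<^sup>2))"
    by (subst sum.swap)
      (simp add: gauss_sum_def cnj_sum sum_product unity_add flip: unity_minus add_uminus_conv_diff)
  also have "\<dots> = (\<Sum>y\<in>?I. \<Sum>d\<in>?I. unity p (k * (d + y)\<^sup>2 - k * y\<^sup>2))"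
  proof (rule sum.cong[OF refl])
    fix y
    show "(\<Sum>x\<in>?I. unity p (k * x\<^sup>2 - k * y\<^sup>2)) = (\<Sum>d\<in>?I. unity p (k * (d + y)\<^sup>2 - k * y\<^sup>2))"
      by (rule sum_periodic_shift[symmetric])
        (auto intro!: unity_cong cong_diff cong_mult cong_pow simp: pos)
  qed
  also have "\<dots> = (\<Sum>d\<in>?I. unity p (k * d\<^sup>2) * (\<Sum>y\<in>?I. unity p (y * (2 * k * d))))"
    by (subst sum.swap) (simp add: sum_distrib_left power2_eq_square algebra_simps flip: unity_add)
  also have "\<dots> = (\<Sum>d\<in>?I. if d = 0 then of_nat p else 0)"
  proof (rule sum.cong[OF refl])
    fix d assume d: "d \<in> ?I"
    have "int p dvd 2 * k * d \<longleftrightarrow> int p dvd d"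
    proof -
      have "\<not> int p dvd 2" using p
        by (metis even_of_nat int_dvd_int_iff of_nat_numeral prime_nat_iff primes_dvd_imp_eq two_is_prime_nat)
      then show ?thesis using k p by (simp add: prime_dvd_mult_iff)
    qed
    also have "\<dots> \<longleftrightarrow> d = 0"
      using d by (auto simp: dvd_eq_mod_eq_0)
    finally show "unity p (k * d\<^sup>2) * (\<Sum>y\<in>?I. unity p (y * (2 * k * d))) = (if d = 0 then of_nat p else 0)"
      unfolding sum_unity[OF pos] by simp
  qed
  also have "\<dots> = of_nat p" using pos by simp
  finally have "complex_of_real ((cmod (gauss_sum p k))\<^sup>2) = of_real (real p)"
    unfolding complex_norm_square by simp
  then have "(cmod (gauss_sum p k))\<^sup>2 = real p" by (simp only: of_real_eq_iff)
  then show ?thesis by (metis norm_ge_zero real_sqrt_unique)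
qed

lemma QuadRes_minus_1_iff:
  assumes "prime p" "odd p"
  shows "QuadRes (int p) (- 1) \<longleftrightarrow> p mod 4 = 1"
proof -
  have p2: "p > 2" using assms prime_ge_2_nat[of p] by (cases "p = 2") auto
  have nz: "\<not> [- 1 = 0] (mod int p)" using p2 by (simp add: cong_iff_dvd_diff)
  have neq: "\<not> [1 = - 1] (mod int p)"
    using p2 by (auto simp: cong_iff_dvd_diff dest: zdvd_imp_le)
  have "[Legendre (- 1) (int p) = (- 1) ^ ((p - 1) div 2)] (mod int p)"
    using euler_criterion[OF assms(1) p2, of "- 1"] by simp
  moreover have "even ((p - 1) div 2) \<longleftrightarrow> p mod 4 = 1"
    using assms(2) by presburger
  ultimately show ?thesis
    using nz neq by (auto simp: Legendre_def cong_sym_eq split: if_splits)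
qed

text \<open>
  A square root \<open>i\<close> of \<open>-1\<close> gives a permutation \<open>x \<mapsto> i * x\<close> of the residues that turns the sum into its
  conjugate.
\<close>

lemma Im_gauss_sum:
  assumes p: "prime p" "p mod 4 = 1"
  shows "Im (gauss_sum p k) = 0"
proof -
  have pos: "int p > 0" using p by (simp add: prime_gt_0_nat)
  have "odd p" using p(2) by presburger
  then obtain i where i: "[i\<^sup>2 = - 1] (mod int p)"
    using QuadRes_minus_1_iff[of p] p by (auto simp: QuadRes_def)
  have inverse: "[i * (- i) = 1] (mod int p)"
    using cong_minus_minus_iff[of "i\<^sup>2" "- 1"] i by (simp add: power2_eq_square)
  then have "gauss_sum p k = (\<Sum>x\<in>{0..<int p}. unity p (k * (i * x)\<^sup>2))"
    unfolding gauss_sum_def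
    by (intro sum_periodic_scale[OF _ inverse, symmetric])
      (use pos in \<open>auto intro!: unity_cong cong_mult cong_pow\<close>)
  also have "\<dots> = (\<Sum>x\<in>{0..<int p}. unity p (- (k * x\<^sup>2)))"
  proof (intro sum.cong[OF refl] unity_cong)
    fix x
    have "[k * x\<^sup>2 * i\<^sup>2 = k * x\<^sup>2 * (- 1)] (mod int p)" using i by (rule cong_scalar_left)
    then show "[k * (i * x)\<^sup>2 = - (k * x\<^sup>2)] (mod int p)" by (simp add: power_mult_distrib mult_ac)
  qed (use pos in auto)
  also have "\<dots> = cnj (gauss_sum p k)"
    by (simp add: gauss_sum_def unity_minus)
  finally show ?thesis by (simp add: complex_eq_iff)
qed

lemma no_sum_two_squares:
  assumes p: "prime p" "p mod 4 = 3" and "\<not> int p dvd z"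
  shows "\<not> int p dvd y\<^sup>2 + z\<^sup>2"
proof
  assume d: "int p dvd y\<^sup>2 + z\<^sup>2"
  have "coprime z (int p)" using assms
    by (metis coprime_commute prime_imp_coprime prime_nat_int_transfer)
  then obtain u where u: "[z * u = 1] (mod int p)" using cong_solve_coprime_int by blast
  have "[(y\<^sup>2 + z\<^sup>2) * u\<^sup>2 = 0] (mod int p)" using d by (simp add: cong_0_iff)
  then have "[(y * u)\<^sup>2 + (z * u)\<^sup>2 = 0] (mod int p)" by (simp add: algebra_simps power_mult_distrib)
  moreover have "[(y * u)\<^sup>2 + (z * u)\<^sup>2 = (y * u)\<^sup>2 + 1\<^sup>2] (mod int p)"
    using u by (intro cong_add cong_pow cong_refl)
  ultimately have "[(y * u)\<^sup>2 = - 1] (mod int p)"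
    by (metis (no_types, lifting) cong_def cong_iff_dvd_diff cong_0_iff cong_trans cong_sym diff_minus_eq_add one_power2)
  then have "QuadRes (int p) (- 1)" by (auto simp: QuadRes_def)
  moreover have "odd p" using p(2) by presburger
  ultimately show False using QuadRes_minus_1_iff p by simp
qed

text \<open>
  Since \<open>-1\<close> is a nonresidue, every nonzero residue \<open>r\<close> is of exactly one of the forms \<open>y\<^sup>2\<close> and \<open>-y\<^sup>2\<close>,
  in two ways. Hence the sum and its conjugate together run twice over all residues, and this total
  vanishes.
\<close>

lemma Re_gauss_sum:
  assumes p: "prime p" "p mod 4 = 3" and k: "\<not> int p dvd k"
  shows "Re (gauss_sum p k) = 0"
proof -
  have pos: "p > 0" using p by (simp add: prime_gt_0_nat)
  let ?J = "{1..<int p}"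
  \<comment> \<open>One square root from each pair \<open>y\<close>, \<open>p - y\<close> is used for the residue \<open>y\<^sup>2\<close> and the other for \<open>-y\<^sup>2\<close>,
    which makes this map a permutation of the nonzero residues.\<close>
  define \<phi> where "\<phi> y = (if 2 * y < int p then y\<^sup>2 else - y\<^sup>2) mod int p" for y
  have J: "\<not> int p dvd y" if "y \<in> ?J" for y
    using that zdvd_not_zless[of y "int p"] by auto
  have inj: "inj_on \<phi> ?J"
  proof (rule inj_onI)
    fix y z assume y: "y \<in> ?J" and z: "z \<in> ?J" and eq: "\<phi> y = \<phi> z"
    show "y = z"
    proof (cases "2 * y < int p \<longleftrightarrow> 2 * z < int p")
      case True
      then have "int p dvd y\<^sup>2 - z\<^sup>2 \<or> int p dvd - (y\<^sup>2 - z\<^sup>2)"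
        using eq by (auto simp: \<phi>_def mod_eq_dvd_iff split: if_splits)
      then have "int p dvd (y - z) * (y + z)"
        by (simp only: dvd_minus_iff) (simp add: power2_eq_square algebra_simps)
      then have "int p dvd y - z \<or> int p dvd y + z"
        using p by (simp add: prime_dvd_mult_iff)
      then show ?thesis
      proof
        assume "int p dvd y - z"
        then have "y mod int p = z mod int p" by (simp add: mod_eq_dvd_iff)
        then show ?thesis using y z by simp
      next
        assume d: "int p dvd y + z"
        have "odd p" using p(2) by presburger
        show ?thesis
        proof (cases "2 * y < int p")
          case less: True
          then have "0 < y + z" "y + z < int p" using True y z by auto
          then show ?thesis using d zdvd_not_zless by blast
        next
          case ge: False
          then have "2 * y \<noteq> int p" "2 * z \<noteq> int p" using \<open>odd p\<close> by presburger+
          then have "0 < y + z - int p" "y + z - int p < int p" using ge True y z by auto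
          moreover have "int p dvd y + z - int p" using d by simp
          ultimately show ?thesis using zdvd_not_zless by blast
        qed
      qed
    next
      case False
      then have "int p dvd y\<^sup>2 + z\<^sup>2 \<or> int p dvd - (y\<^sup>2 + z\<^sup>2)"
        using eq by (auto simp: \<phi>_def mod_eq_dvd_iff algebra_simps split: if_splits)
      then show ?thesis
        using no_sum_two_squares[OF p J[OF z], of y] by (simp only: dvd_minus_iff) blast
    qed
  qed
  have "\<phi> ` ?J = ?J"
  proof (rule card_subset_eq)
    show "\<phi> ` ?J \<subseteq> ?J"
    proof
      fix r assume "r \<in> \<phi> ` ?J"
      then obtain y where y: "y \<in> ?J" "r = \<phi> y" by blast
      then have "\<not> int p dvd y\<^sup>2" using J p by (simp add: prime_dvd_power_iff)
      then have "r \<noteq> 0" using y(2) by (auto simp: \<phi>_def dvd_eq_mod_eq_0[symmetric])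
      moreover have "0 \<le> r" "r < int p" using y pos by (auto simp: \<phi>_def)
      ultimately show "r \<in> ?J" by auto
    qed
  qed (use inj in \<open>simp_all add: card_image\<close>)
  then have bij: "(\<Sum>y\<in>?J. unity p (k * \<phi> y)) = (\<Sum>r\<in>?J. unity p (k * r))"
    using sum.reindex[OF inj, of "\<lambda>r. unity p (k * r)"] by simp
  have split0: "{0..<int p} = insert 0 ?J" using pos by auto
  have "(\<Sum>r\<in>?J. unity p (k * r)) = - 1"
    using sum_unity[OF pos, of k] k by (simp add: split0 mult.commute add_eq_0_iff)
  moreover have "(\<Sum>y\<in>?J. unity p (k * \<phi> (int p - y))) = (\<Sum>y\<in>?J. unity p (k * \<phi> y))"
    by (rule sum.reindex_bij_witness[of _ "\<lambda>y. int p - y" "\<lambda>y. int p - y"]) auto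
  ultimately have "- 2 = (\<Sum>y\<in>?J. unity p (k * \<phi> y) + unity p (k * \<phi> (int p - y)))"
    using bij by (simp add: sum.distrib)
  also have "\<dots> = (\<Sum>y\<in>?J. unity p (k * y\<^sup>2) + unity p (- (k * y\<^sup>2)))"
  proof (rule sum.cong[OF refl])
    fix y assume y: "y \<in> ?J"
    have *: "unity p (k * (t mod int p)) = unity p (k * t)" for t
      using pos by (intro unity_cong cong_mult) auto
    have sq: "[(int p - y)\<^sup>2 = y\<^sup>2] (mod int p)"
      by (simp add: cong_iff_dvd_diff power2_eq_square algebra_simps)
    have **: "unity p (k * (int p - y)\<^sup>2) = unity p (k * y\<^sup>2)"
      "unity p (k * - (int p - y)\<^sup>2) = unity p (k * - y\<^sup>2)"
      using sq pos by (auto intro!: unity_cong cong_mult simp: cong_minus_minus_iff simp del: mult_minus_right)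
    have "odd p" using p(2) by presburger
    then have "2 * (int p - y) < int p \<longleftrightarrow> \<not> 2 * y < int p" by presburger
    then show "unity p (k * \<phi> y) + unity p (k * \<phi> (int p - y)) = unity p (k * y\<^sup>2) + unity p (- (k * y\<^sup>2))"
      unfolding \<phi>_def * using ** by simp
  qed
  also have "\<dots> = gauss_sum p k + cnj (gauss_sum p k) - 2"
    by (simp add: gauss_sum_def split0 sum.distrib unity_minus)
  finally have "gauss_sum p k + cnj (gauss_sum p k) = 0" by simp
  then show ?thesis by (simp add: complex_eq_iff)
qed

section \<open>The local weights and their Fourier transforms\<close>

text \<open>
  For odd \<open>p\<close> this is the indicator function of the nonzero quadratic residues: the two roots of
  each of them cancel the factor one half.
\<close>

definition square_weight :: "nat \<Rightarrow> int \<Rightarrow> real" where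
  "square_weight p x = card {y \<in> {1..<int p}. [y\<^sup>2 = x] (mod int p)} / 2"

text \<open>
  The Fourier transform of the local weight, with the sum over residues already replaced by a sum
  over square roots.
\<close>

definition square_hat :: "nat \<Rightarrow> int \<Rightarrow> complex" where
  "square_hat p k = (\<Sum>y\<in>{1..<int p}. unity p (- (k * y\<^sup>2))) / 2"

lemma square_hat_0: "square_hat p 0 = of_real (real (p - 1) / 2)"
  by (cases p) (simp_all add: square_hat_def)

lemma square_hat_eq_gauss_sum:
  assumes "p > 0"
  shows "square_hat p k = (gauss_sum p (- k) - 1) / 2"
proof -
  have "{0..<int p} = insert 0 {1..<int p}" using assms by auto
  then show ?thesis by (simp add: square_hat_def gauss_sum_def)
qed

text \<open>
  For \<open>p\<close> of the form \<open>4k+3\<close> the transform is nearly purely imaginary: its real part is smaller than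
  its imaginary part by a factor of order the square root of \<open>p\<close>. This is the source of the saving
  in terms of \<open>q\<close> in the final bound.
\<close>

lemma square_hat_bounds_3_mod_4:
  assumes "prime p" "p mod 4 = 3" "\<not> int p dvd k"
  shows "\<bar>Re (square_hat p k)\<bar> \<le> 1 / 2" "\<bar>Im (square_hat p k)\<bar> \<le> sqrt p / 2"
proof -
  have pos: "p > 0" using assms by (simp add: prime_gt_0_nat)
  have "odd p" using assms(2) by presburger
  then have "\<bar>Im (gauss_sum p (- k))\<bar> \<le> sqrt p"
    using norm_gauss_sum[of p "- k"] abs_Im_le_cmod[of "gauss_sum p (- k)"] assms by simp
  then show "\<bar>Im (square_hat p k)\<bar> \<le> sqrt p / 2"
    by (simp add: square_hat_eq_gauss_sum[OF pos])
  show "\<bar>Re (square_hat p k)\<bar> \<le> 1 / 2"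
    using Re_gauss_sum[of p "- k"] assms by (simp add: square_hat_eq_gauss_sum[OF pos])
qed

text \<open>
  Here \<open>-1\<close> is a square, so the Gauss sum is real. The prime \<open>2\<close>, to which the evaluation of the Gauss
  sum does not apply, has the single nonzero square \<open>1\<close> and is treated by hand.
\<close>

lemma square_hat_bounds_not_3_mod_4:
  assumes "prime p" "p mod 4 \<noteq> 3" "\<not> int p dvd k"
  shows "\<bar>Re (square_hat p k)\<bar> \<le> sqrt p" "Im (square_hat p k) = 0"
proof -
  have pos: "p > 0" and p2: "p \<ge> 2" using assms by (simp_all add: prime_gt_0_nat prime_ge_2_nat)
  have s1: "1 \<le> sqrt p" using p2 by simp
  have "\<bar>Re (square_hat p k)\<bar> \<le> sqrt p \<and> Im (square_hat p k) = 0"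
  proof (cases "p = 2")
    case True
    have set: "{1..<2} = {1 :: int}" by auto
    have "unity 2 (- k) ^ 2 = 1"
      using unity_eq_1_iff[of 2 "2 * (- k)"] unity_add[of 2 "- k" "- k"]
      by (simp add: power2_eq_square)
    then have "unity 2 (- k) = 1 \<or> unity 2 (- k) = - 1" by (simp add: power2_eq_1_iff)
    moreover have "1 \<le> sqrt 2 * (2::real)" using real_sqrt_ge_one[of 2] by linarith
    ultimately show ?thesis using True by (auto simp: square_hat_def set)
  next
    case False
    then have odd: "odd p" using assms(1) primes_dvd_imp_eq two_is_prime_nat by blast
    then have "p mod 4 = 1" using assms(2) by presburger
    then have "Im (gauss_sum p (- k)) = 0" using Im_gauss_sum assms by simp
    moreover have "\<bar>Re (gauss_sum p (- k))\<bar> \<le> sqrt p"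
      using norm_gauss_sum[of p "- k"] abs_Re_le_cmod[of "gauss_sum p (- k)"] odd assms by simp
    then have "\<bar>(Re (gauss_sum p (- k)) - 1) / 2\<bar> \<le> sqrt p"
      using s1 by (auto simp: abs_le_iff simp del: real_sqrt_ge_1_iff)
    ultimately show ?thesis by (simp add: square_hat_eq_gauss_sum[OF pos])
  qed
  then show "\<bar>Re (square_hat p k)\<bar> \<le> sqrt p" "Im (square_hat p k) = 0" by auto
qed

lemma square_weight_fourier:
  assumes "p > 0"
  shows "of_real (square_weight p x) * of_nat p = (\<Sum>k\<in>{0..<int p}. square_hat p k * unity p (k * x))"
proof -
  let ?Y = "{1..<int p}"
  have "(\<Sum>k\<in>{0..<int p}. square_hat p k * unity p (k * x))
      = (\<Sum>k\<in>{0..<int p}. \<Sum>y\<in>?Y. unity p (k * (x - y\<^sup>2))) / 2"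
    unfolding square_hat_def sum_divide_distrib sum_distrib_right
    by (simp add: algebra_simps flip: unity_add)
  also have "\<dots> = (\<Sum>y\<in>?Y. if int p dvd x - y\<^sup>2 then of_nat p else 0) / 2"
    by (subst sum.swap) (simp only: sum_unity[OF assms])
  also have "\<dots> = (\<Sum>y\<in>{y \<in> ?Y. [y\<^sup>2 = x] (mod int p)}. of_nat p) / 2"
    by (subst sum.inter_filter) (simp_all add: cong_sym_eq cong_iff_dvd_diff dvd_diff_commute)
  finally show ?thesis by (simp add: square_weight_def)
qed

section \<open>Products of local transforms\<close>

text \<open>
  A product of transforms over a set with an odd number of primes \<open>4k+3\<close> is nearly imaginary. If all
  these primes are at least \<open>q\<close>, this factor measures how much smaller its real part is.
\<close>

definition parity_gain :: "real \<Rightarrow> nat set \<Rightarrow> real" where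
  "parity_gain q S = (if odd (card {p \<in> S. p mod 4 = 3}) then sqrt q else 1)"

lemma parity_gain_Un:
  assumes "finite S" "finite T" "S \<inter> T = {}" "q \<ge> 1"
  shows "parity_gain q (S \<union> T) \<le> parity_gain q S * parity_gain q T"
proof -
  have "{p \<in> S \<union> T. p mod 4 = 3} = {p \<in> S. p mod 4 = 3} \<union> {p \<in> T. p mod 4 = 3}" by auto
  then have "card {p \<in> S \<union> T. p mod 4 = 3} = card {p \<in> S. p mod 4 = 3} + card {p \<in> T. p mod 4 = 3}"
    using assms by (subst card_Un_disjoint[symmetric]) auto
  then show ?thesis using assms by (auto simp: parity_gain_def)
qed

text \<open>
  The factor \<open>a + \<i> b\<close> is nearly imaginary. If \<open>x + \<i> y\<close> has modulus of order \<open>r\<close> and \<open>y\<close> is smaller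
  than that by \<open>t\<close>, then in the product the roles of the two parts are exchanged: now the real part
  is the small one. The variants with the other signs serve the case where \<open>x\<close> is the small part.
\<close>

lemma mult_near_imaginary:
  fixes a b x y r s t :: real
  assumes "\<bar>a\<bar> \<le> 1 / 2" "\<bar>b\<bar> \<le> s / 2" "1 \<le> t" "t \<le> s" "\<bar>x\<bar> \<le> r" "\<bar>y\<bar> * t \<le> r"
  shows "\<bar>a * x - b * y\<bar> * t \<le> s * r" "\<bar>a * x + b * y\<bar> * t \<le> s * r"
    "\<bar>a * y + b * x\<bar> \<le> s * r" "\<bar>a * y - b * x\<bar> \<le> s * r"
proof -
  have r: "0 \<le> r" using assms by linarith
  have yr: "\<bar>y\<bar> \<le> r" using assms mult_left_mono[of 1 t "\<bar>y\<bar>"] by simp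
  have "\<bar>a * x\<bar> * t \<le> (1 / 2 * r) * s"
    unfolding abs_mult using assms r by (intro mult_mono) auto
  moreover have "\<bar>b\<bar> * (\<bar>y\<bar> * t) \<le> (s / 2) * r"
    using assms r by (intro mult_mono) auto
  ultimately have "(\<bar>a * x\<bar> + \<bar>b * y\<bar>) * t \<le> s * r"
    by (simp add: abs_mult algebra_simps)
  moreover have "\<bar>a * x - b * y\<bar> * t \<le> (\<bar>a * x\<bar> + \<bar>b * y\<bar>) * t"
    "\<bar>a * x + b * y\<bar> * t \<le> (\<bar>a * x\<bar> + \<bar>b * y\<bar>) * t"
    using assms by (intro mult_right_mono; linarith)+
  ultimately show "\<bar>a * x - b * y\<bar> * t \<le> s * r" "\<bar>a * x + b * y\<bar> * t \<le> s * r" by linarith+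
  have "\<bar>a * y\<bar> \<le> 1 / 2 * r" "\<bar>b * x\<bar> \<le> s / 2 * r" "1 * r \<le> s * r"
    unfolding abs_mult using assms yr r by (intro mult_mono; auto)+
  then show "\<bar>a * y + b * x\<bar> \<le> s * r" "\<bar>a * y - b * x\<bar> \<le> s * r" by linarith+
qed

text \<open>
  Each factor is real, or nearly imaginary when \<open>p\<close> has the form \<open>4k+3\<close>. So the
  parity of the number of primes \<open>4k+3\<close> decides which part of the product is the small one, and the
  induction has to carry bounds for both parts.
\<close>

lemma Re_prod_bound:
  fixes z :: "nat \<Rightarrow> complex" and q :: real
  assumes "finite T" "1 \<le> q"
    and "\<And>p. p \<in> T \<Longrightarrow> p mod 4 = 3 \<Longrightarrow> q \<le> p \<and> \<bar>Re (z p)\<bar> \<le> 1 / 2 \<and> \<bar>Im (z p)\<bar> \<le> sqrt p / 2"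
    and "\<And>p. p \<in> T \<Longrightarrow> p mod 4 \<noteq> 3 \<Longrightarrow> \<bar>Re (z p)\<bar> \<le> sqrt p \<and> Im (z p) = 0"
  shows "\<bar>Re (\<Prod>p\<in>T. z p)\<bar> * parity_gain q T \<le> (\<Prod>p\<in>T. sqrt p)"
proof -
  let ?N = "\<lambda>T. card {p \<in> T. p mod 4 = 3}" and ?z = "\<lambda>T. \<Prod>p\<in>T. z p"
  let ?r = "\<lambda>T. \<Prod>p\<in>T. sqrt (real p)"
  have "if odd (?N T) then \<bar>Im (?z T)\<bar> \<le> ?r T \<and> \<bar>Re (?z T)\<bar> * sqrt q \<le> ?r T
      else \<bar>Re (?z T)\<bar> \<le> ?r T \<and> \<bar>Im (?z T)\<bar> * sqrt q \<le> ?r T"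
    using assms
  proof (induction T rule: finite_induct)
    case empty
    then show ?case by simp
  next
    case (insert p T)
    have IH: "if odd (?N T) then \<bar>Im (?z T)\<bar> \<le> ?r T \<and> \<bar>Re (?z T)\<bar> * sqrt q \<le> ?r T
      else \<bar>Re (?z T)\<bar> \<le> ?r T \<and> \<bar>Im (?z T)\<bar> * sqrt q \<le> ?r T"
      using insert by simp
    show ?case
    proof (cases "p mod 4 = 3")
      case True
      then have "{r \<in> insert p T. r mod 4 = 3} = insert p {r \<in> T. r mod 4 = 3}" by auto
      then have N: "?N (insert p T) = Suc (?N T)" using insert by simp
      have z: "\<bar>Re (z p)\<bar> \<le> 1 / 2" "\<bar>Im (z p)\<bar> \<le> sqrt p / 2" "1 \<le> sqrt q" "sqrt q \<le> sqrt p"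
        using insert.prems True by auto
      show ?thesis
        using IH mult_near_imaginary[OF z, of "Re (?z T)" "?r T" "Im (?z T)"]
          mult_near_imaginary[OF z, of "Im (?z T)" "?r T" "Re (?z T)"] insert.hyps
        unfolding N by (auto split: if_splits)
    next
      case False
      then have "{r \<in> insert p T. r mod 4 = 3} = {r \<in> T. r mod 4 = 3}" by auto
      then have N: "?N (insert p T) = ?N T" by simp
      have z: "\<bar>Re (z p)\<bar> \<le> sqrt p" "Im (z p) = 0" using insert.prems False by auto
      have scale: "\<bar>Re (z p)\<bar> * u \<le> sqrt p * ?r T" if "u \<le> ?r T" "0 \<le> u" for u
        using z that by (intro mult_mono) auto
      show ?thesis
        using IH scale[of "\<bar>Re (?z T)\<bar>"] scale[of "\<bar>Im (?z T)\<bar>"] insert.prems(1)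
          scale[of "\<bar>Re (?z T)\<bar> * sqrt q"] scale[of "\<bar>Im (?z T)\<bar> * sqrt q"] insert.hyps z(2)
        unfolding N by (auto simp: abs_mult mult.assoc split: if_splits)
    qed
  qed
  then show ?thesis by (auto simp: parity_gain_def split: if_splits)
qed

section \<open>Positivity of the Fourier transform of the test function\<close>

text \<open>
  The weight of a face \<open>S\<close> of the test function. Dividing by the square root of the product of \<open>S\<close>
  balances the size of the Gauss sums; the parity gain is extra weight that is affordable because the
  real parts are smaller by the same factor; and the powers of a small \<open>x\<close> make the terms of larger faces sum to less than
  the one that they are compared with.
\<close>

definition coefficient :: "real \<Rightarrow> real \<Rightarrow> nat set \<Rightarrow> real" where
  "coefficient q x S = x ^ card S * parity_gain q S / (\<Prod>p\<in>S. sqrt p)"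

lemma coefficient_nonneg: "0 \<le> x \<Longrightarrow> 0 \<le> q \<Longrightarrow> 0 \<le> coefficient q x S"
  by (auto simp: coefficient_def parity_gain_def intro!: divide_nonneg_nonneg mult_nonneg_nonneg prod_nonneg)

lemma sum_Pow_power_card:
  fixes x :: real
  assumes "finite N"
  shows "(\<Sum>T\<in>Pow N. x ^ card T) = (1 + x) ^ card N"
  using prod_add[OF assms, of "\<lambda>_. x" "\<lambda>_. 1"] by (simp add: add.commute)

lemma sum_Pow_Un:
  fixes F :: "'a set \<Rightarrow> 'b::comm_monoid_add"
  assumes "finite Z" "finite N" "Z \<inter> N = {}"
  shows "(\<Sum>X\<in>Pow (Z \<union> N). F X) = (\<Sum>S\<in>Pow Z. \<Sum>T\<in>Pow N. F (S \<union> T))"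
  unfolding sum.cartesian_product
  by (rule sum.reindex_bij_witness[of _ "\<lambda>(S, T). S \<union> T" "\<lambda>X. (X \<inter> Z, X \<inter> N)"])
    (use assms in \<open>auto simp: Int_absorb2 simp flip: Int_Un_distrib\<close>)

text \<open>
  \<open>Z\<close> is the set of primes where a frequency vanishes, so there the local transforms are
  nonnegative reals, and \<open>N\<close> is the set of the others. Group the faces by their intersection \<open>S\<close> with \<open>Z\<close>. The face
  \<open>S\<close> itself gives a nonnegative term. A larger face \<open>S \<union> T\<close> gives in absolute value at most \<open>x ^ card T\<close> times that term:
  the bound on the real part of the product over \<open>T\<close> cancels the factor of the coefficient that
  belongs to \<open>T\<close>, because the parity gain is submultiplicative. All nonempty \<open>T\<close> together
  contribute \<open>(1 + x) ^ card N - 1 \<le> 1\<close> of that term, so the term wins.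
\<close>

lemma sum_coefficient_nonneg:
  fixes z :: "nat \<Rightarrow> complex" and q x :: real
  assumes fin: "finite Z" "finite N" and disj: "Z \<inter> N = {}"
    and q: "1 \<le> q" and x: "0 \<le> x" "(1 + x) ^ card N \<le> 2"
    and pos: "\<And>p. p \<in> N \<Longrightarrow> p > 0"
    and real: "\<And>p. p \<in> Z \<Longrightarrow> z p = of_real (g p) \<and> 0 \<le> g p"
    and "\<And>p. p \<in> N \<Longrightarrow> p mod 4 = 3 \<Longrightarrow> q \<le> p \<and> \<bar>Re (z p)\<bar> \<le> 1 / 2 \<and> \<bar>Im (z p)\<bar> \<le> sqrt p / 2"
    and "\<And>p. p \<in> N \<Longrightarrow> p mod 4 \<noteq> 3 \<Longrightarrow> \<bar>Re (z p)\<bar> \<le> sqrt p \<and> Im (z p) = 0"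
  shows "0 \<le> (\<Sum>X\<in>Pow (Z \<union> N). coefficient q x X * Re (\<Prod>p\<in>X. z p))"
  unfolding sum_Pow_Un[OF fin disj]
proof (rule sum_nonneg)
  fix S assume S: "S \<in> Pow Z"
  let ?c = "coefficient q x" and ?r = "\<lambda>T. \<Prod>p\<in>T. sqrt (real p)"
  define G where "G = (\<Prod>p\<in>S. g p)"
  have G: "0 \<le> G" "(\<Prod>p\<in>S. z p) = of_real G"
    using S real unfolding G_def of_real_prod by (auto intro!: prod_nonneg prod.cong)
  have finS: "finite S" using S fin finite_subset by auto
  have c0: "0 \<le> ?c X" for X using q x by (intro coefficient_nonneg) auto
  have term_bound: "?c S * G * (2 * of_bool (T = {}) - x ^ card T) \<le> ?c (S \<union> T) * Re (\<Prod>p\<in>S \<union> T. z p)"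
    if T: "T \<in> Pow N" for T
  proof (cases "T = {}")
    case True
    then show ?thesis using G by simp
  next
    case False
    have finT: "finite T" using T fin finite_subset by auto
    have ST: "S \<inter> T = {}" using S T disj by blast
    define R where "R = Re (\<Prod>p\<in>T. z p)"
    have Re: "Re (\<Prod>p\<in>S \<union> T. z p) = G * R"
      using prod.union_disjoint[OF finS finT ST, of z] G by (simp add: R_def)
    have rT: "?r T > 0" using T pos by (intro prod_pos) auto
    have R: "\<bar>R\<bar> * parity_gain q T \<le> ?r T"
      unfolding R_def using T assms by (intro Re_prod_bound finT) auto
    have "?c (S \<union> T) * \<bar>R\<bar> = x ^ card S * x ^ card T * parity_gain q (S \<union> T) / (?r S * ?r T) * \<bar>R\<bar>"
      unfolding coefficient_def card_Un_disjoint[OF finS finT ST]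
        prod.union_disjoint[OF finS finT ST] by (simp add: power_add)
    also have "\<dots> \<le> x ^ card S * x ^ card T * (parity_gain q S * parity_gain q T) / (?r S * ?r T) * \<bar>R\<bar>"
      using x parity_gain_Un[OF finS finT ST q]
      by (intro mult_right_mono divide_right_mono mult_left_mono) (auto intro!: mult_nonneg_nonneg prod_nonneg)
    also have "\<dots> = ?c S * x ^ card T * ((\<bar>R\<bar> * parity_gain q T) / ?r T)"
      by (simp add: coefficient_def)
    also have "\<dots> \<le> ?c S * x ^ card T * 1"
      using R rT x c0 by (intro mult_left_mono) (auto simp: divide_le_eq)
    finally have "?c (S \<union> T) * \<bar>R\<bar> * G \<le> ?c S * x ^ card T * G"
      using G by (intro mult_right_mono) auto
    moreover have "- (?c (S \<union> T) * \<bar>R\<bar> * G) \<le> ?c (S \<union> T) * (G * R)"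
      using mult_left_mono[of "- \<bar>R\<bar>" R "?c (S \<union> T) * G"] G c0[of "S \<union> T"]
      by (simp add: mult_ac)
    ultimately show ?thesis using False unfolding Re by (simp add: mult_ac)
  qed
  have "(\<Sum>T\<in>Pow N. 2 * of_bool (T = {}) - x ^ card T) = 2 - (1 + x) ^ card N"
    using fin by (simp add: sum_subtractf sum_Pow_power_card of_bool_def sum.delta flip: sum_distrib_left)
  then have "0 \<le> ?c S * G * (\<Sum>T\<in>Pow N. 2 * of_bool (T = {}) - x ^ card T)"
    using x c0 G by simp
  also have "\<dots> \<le> (\<Sum>T\<in>Pow N. ?c (S \<union> T) * Re (\<Prod>p\<in>S \<union> T. z p))"
    unfolding sum_distrib_left using term_bound by (intro sum_mono)
  finally show "0 \<le> (\<Sum>T\<in>Pow N. ?c (S \<union> T) * Re (\<Prod>p\<in>S \<union> T. z p))" .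
qed

section \<open>Test functions supported on squares\<close>

text \<open>
  The term of \<open>S\<close> lives on the integers that are nonzero squares modulo the primes of \<open>S\<close> and vanish
  modulo the other primes of \<open>M\<close>. These supports partition the squares modulo the product of \<open>M\<close>.
\<close>

definition test_function :: "nat set \<Rightarrow> (nat set \<Rightarrow> real) \<Rightarrow> int \<Rightarrow> real" where
  "test_function M c x =
     (\<Sum>S\<in>Pow M. c S * (\<Prod>p\<in>M. if p \<in> S then square_weight p x else of_bool (int p dvd x)))"

text \<open>
  Each local factor is a sum over frequencies modulo \<open>p\<close>; multiplying these sums out yields
  one frequency for every prime. Working with such families of frequencies avoids identifying
  them with the residues modulo the product.
\<close>

lemma test_function_fourier:
  assumes fin: "finite M" and pos: "\<And>p. p \<in> M \<Longrightarrow> p > 0"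
  shows "of_real (test_function M c x) * of_nat (\<Prod>M)
    = (\<Sum>k\<in>PiE M (\<lambda>p. {0..<int p}).
        (\<Sum>S\<in>Pow M. of_real (c S) * (\<Prod>p\<in>S. square_hat p (k p))) * (\<Prod>p\<in>M. unity p (k p * x)))"
proof -
  let ?K = "PiE M (\<lambda>p. {0..<int p})"
  let ?h = "\<lambda>S p k. if p \<in> S then square_hat p k else 1"
  have "of_real (test_function M c x) * of_nat (\<Prod>M)
      = (\<Sum>S\<in>Pow M. of_real (c S) *
          (\<Prod>p\<in>M. of_real (if p \<in> S then square_weight p x else of_bool (int p dvd x)) * of_nat p :: complex))"
    by (simp add: test_function_def sum_distrib_right prod.distrib mult.assoc)
  also have "\<dots> = (\<Sum>S\<in>Pow M. of_real (c S) * (\<Prod>p\<in>M. \<Sum>k\<in>{0..<int p}. ?h S p k * unity p (k * x)))"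
  proof (intro sum.cong prod.cong arg_cong2[where f = "(*)"] refl)
    fix S p assume "p \<in> M"
    then have "p > 0" by (rule pos)
    then show "of_real (if p \<in> S then square_weight p x else of_bool (int p dvd x)) * of_nat p
        = (\<Sum>k\<in>{0..<int p}. ?h S p k * unity p (k * x))"
      by (simp add: square_weight_fourier sum_unity)
  qed
  also have "\<dots> = (\<Sum>S\<in>Pow M. of_real (c S) * (\<Sum>k\<in>?K. \<Prod>p\<in>M. ?h S p (k p) * unity p (k p * x)))"
    using fin by (simp add: prod_sum_PiE)
  also have "\<dots> = (\<Sum>S\<in>Pow M. \<Sum>k\<in>?K.
      of_real (c S) * (\<Prod>p\<in>S. square_hat p (k p)) * (\<Prod>p\<in>M. unity p (k p * x)))"
  proof -
    have "(\<Prod>p\<in>M. ?h S p (k p)) = (\<Prod>p\<in>S. square_hat p (k p))" if "S \<in> Pow M" for S k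
      using that prod.inter_restrict[OF fin, of "\<lambda>p. square_hat p (k p)" S] by (simp add: Int_absorb1)
    then show ?thesis
      by (simp add: sum_distrib_left prod.distrib mult.assoc)
  qed
  finally show ?thesis
    by (subst (asm) sum.swap) (simp add: sum_distrib_right)
qed

text \<open>
  Parseval for the pair correlation of \<open>A\<close>. The left side is real, so only the real parts of the
  transform of the test function matter.
\<close>

lemma sum_test_function_differences:
  assumes fin: "finite M" "finite A" and pos: "\<And>p. p \<in> M \<Longrightarrow> p > 0"
  shows "(\<Sum>a\<in>A. \<Sum>b\<in>A. test_function M c (a - b)) * real (\<Prod>M)
    = (\<Sum>k\<in>PiE M (\<lambda>p. {0..<int p}).
        (\<Sum>S\<in>Pow M. c S * Re (\<Prod>p\<in>S. square_hat p (k p))) *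
        (cmod (\<Sum>a\<in>A. \<Prod>p\<in>M. unity p (k p * a)))\<^sup>2)"
proof -
  let ?K = "PiE M (\<lambda>p. {0..<int p})"
  let ?F = "\<lambda>k. \<Sum>S\<in>Pow M. of_real (c S) * (\<Prod>p\<in>S. square_hat p (k p))"
  let ?e = "\<lambda>k a. \<Prod>p\<in>M. unity p (k p * a)"
  have e: "?e k (a - b) = ?e k a * cnj (?e k b)" for k a b
    unfolding diff_conv_add_uminus distrib_left mult_minus_right unity_add unity_minus
    by (simp add: prod.distrib)
  have factor: "(\<Sum>a\<in>A. \<Sum>b\<in>A. u * (f a * cnj (f b))) = u * ((\<Sum>a\<in>A. f a) * cnj (\<Sum>b\<in>A. f b))"
    for u and f :: "int \<Rightarrow> complex"
    unfolding cnj_sum sum_product by (simp only: sum_distrib_left)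
  have "of_real ((\<Sum>a\<in>A. \<Sum>b\<in>A. test_function M c (a - b)) * real (\<Prod>M))
      = (\<Sum>a\<in>A. \<Sum>b\<in>A. of_real (test_function M c (a - b)) * of_nat (\<Prod>M) :: complex)"
    by (simp add: sum_distrib_right)
  also have "\<dots> = (\<Sum>a\<in>A. \<Sum>b\<in>A. \<Sum>k\<in>?K. ?F k * ?e k (a - b))"
    using test_function_fourier[OF fin(1) pos, of c] by (intro sum.cong refl)
  also have "\<dots> = (\<Sum>a\<in>A. \<Sum>k\<in>?K. \<Sum>b\<in>A. ?F k * ?e k (a - b))"
    by (intro sum.cong sum.swap refl)
  also have "\<dots> = (\<Sum>k\<in>?K. \<Sum>a\<in>A. \<Sum>b\<in>A. ?F k * ?e k (a - b))"
    by (rule sum.swap)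
  also have "\<dots> = (\<Sum>k\<in>?K. ?F k * ((\<Sum>a\<in>A. ?e k a) * cnj (\<Sum>b\<in>A. ?e k b)))"
    unfolding e factor ..
  also have "\<dots> = (\<Sum>k\<in>?K. ?F k * of_real ((cmod (\<Sum>a\<in>A. ?e k a))\<^sup>2))"
    by (simp only: complex_norm_square)
  finally have "(\<Sum>a\<in>A. \<Sum>b\<in>A. test_function M c (a - b)) * real (\<Prod>M)
    = Re (\<Sum>k\<in>?K. ?F k * of_real ((cmod (\<Sum>a\<in>A. ?e k a))\<^sup>2))"
    by (metis Re_complex_of_real)
  then show ?thesis by (simp add: Re_sum)
qed

lemma test_function_0:
  assumes "finite M" and prime: "\<And>p. p \<in> M \<Longrightarrow> prime p"
  shows "test_function M c 0 = c {}"
proof -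
  have w: "square_weight p 0 = 0" if "p \<in> M" for p
  proof -
    have "\<not> [y\<^sup>2 = 0] (mod int p)" if "y \<in> {1..<int p}" for y
      using prime[OF \<open>p \<in> M\<close>] that zdvd_not_zless[of y "int p"]
      by (auto simp: cong_0_iff prime_dvd_power_iff)
    then have "{y \<in> {1..<int p}. [y\<^sup>2 = 0] (mod int p)} = {}" by blast
    then show ?thesis unfolding square_weight_def by (simp only: card.empty)
  qed
  have "(\<Prod>p\<in>M. if p \<in> S then square_weight p 0 else of_bool (int p dvd 0)) = of_bool (S = {})"
    if "S \<in> Pow M" for S
  proof (cases "S = {}")
    case False
    then obtain p where "p \<in> S" by blast
    then show ?thesis using that assms(1) w False by (auto intro!: prod_zero bexI[of _ p])
  qed simp
  then have "test_function M c 0 = (\<Sum>S\<in>Pow M. c S * of_bool (S = {}))"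
    unfolding test_function_def by simp
  also have "\<dots> = (\<Sum>S\<in>Pow M. if S = {} then c S else 0)"
    by (intro sum.cong) auto
  finally show ?thesis using assms(1) by simp
qed

text \<open>
  At a point of the support there is a square root modulo each prime of \<open>M\<close>, and the Chinese remainder
  theorem glues these roots together.
\<close>

lemma test_function_nonzero_imp_square:
  assumes fin: "finite M" and prime: "\<And>p. p \<in> M \<Longrightarrow> prime p"
    and nz: "test_function M c x \<noteq> 0"
  shows "\<exists>y. [y\<^sup>2 = x] (mod int (\<Prod>M))"
proof -
  obtain S where S: "(\<Prod>p\<in>M. if p \<in> S then square_weight p x else of_bool (int p dvd x)) \<noteq> 0"
    using nz unfolding test_function_def
    by (rule sum.not_neutral_contains_not_neutral) auto
  have "\<exists>y::nat. [(int y)\<^sup>2 = x] (mod int p)" if p: "p \<in> M" for p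
  proof (cases "p \<in> S")
    case True
    then have "square_weight p x \<noteq> 0" using S p fin by (auto simp: prod_zero_iff)
    then have "{y \<in> {1..<int p}. [y\<^sup>2 = x] (mod int p)} \<noteq> {}"
      unfolding square_weight_def by (metis card.empty div_0 of_nat_0)
    then obtain y where "y \<in> {1..<int p}" "[y\<^sup>2 = x] (mod int p)" by blast
    then show ?thesis by (intro exI[of _ "nat y"]) simp
  next
    case False
    then have "int p dvd x" using S p fin by (auto simp: prod_zero_iff split: if_splits)
    then have "[x = 0] (mod int p)" by (simp add: cong_0_iff)
    then show ?thesis by (intro exI[of _ 0]) (simp add: cong_sym)
  qed
  then obtain u :: "nat \<Rightarrow> nat" where u: "\<And>p. p \<in> M \<Longrightarrow> [(int (u p))\<^sup>2 = x] (mod int p)" by metis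
  have coprime: "coprime p r" if "p \<in> M" "r \<in> M" "p \<noteq> r" for p r
    using that prime by (simp add: primes_coprime)
  then obtain y where y: "\<And>p. p \<in> M \<Longrightarrow> [y = u p] (mod p)"
    using chinese_remainder_nat[OF fin, of "\<lambda>p. p" u] by blast
  have "[(int y)\<^sup>2 = x] (mod (\<Prod>p\<in>M. int p))"
  proof (rule cong_cong_prod_coprime, rule ballI)
    fix p assume p: "p \<in> M"
    have "[int y = int (u p)] (mod int p)" using y[OF p] by (simp add: cong_int_iff)
    then show "[(int y)\<^sup>2 = x] (mod int p)" using u[OF p] cong_pow cong_trans by blast
  qed (use coprime in auto)
  then show ?thesis by auto
qed

section \<open>The bound for sets without square differences\<close>

text \<open>
  The pair correlation equals \<open>card A\<close>, since the test function is \<open>1\<close> at \<open>0\<close> and vanishes at the other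
  differences. On the Fourier side all terms are nonnegative, so the correlation is at least the
  term of the zero frequency, where \<open>card A\<close> occurs squared; of its factor only the contribution of
  the full face \<open>S = M\<close> is kept.
\<close>

lemma card_le_of_differences_avoid_squares:
  fixes M :: "nat set" and A :: "int set" and q :: real
  assumes fin: "finite M" "finite A" and prime: "\<And>p. p \<in> M \<Longrightarrow> prime p"
    and q: "1 \<le> q" "\<And>p. p \<in> M \<Longrightarrow> p mod 4 = 3 \<Longrightarrow> q \<le> p"
    and avoid: "\<And>a b y. a \<in> A \<Longrightarrow> b \<in> A \<Longrightarrow> [y\<^sup>2 = a - b] (mod int (\<Prod>M)) \<Longrightarrow> a = b"
  shows "real (card A) * parity_gain q M \<le> sqrt (real (\<Prod>M)) * (8 * real (card M)) ^ card M"
proof (cases "A = {}")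
  case True
  then show ?thesis by (simp add: prod_nonneg)
next
  case False
  then have A: "real (card A) > 0" using fin by (simp add: card_gt_0_iff)
  have pos: "p > 0" if "p \<in> M" for p using prime[OF that] by (simp add: prime_gt_0_nat)
  define n where "n = card M"
  \<comment> \<open>With this choice \<open>(1 + x) ^ n\<close> stays below \<open>exp (1/2) < 2\<close>. For \<open>n = 0\<close> it reads \<open>x = 0\<close>.\<close>
  define x where "x = 1 / (2 * real n)"
  let ?c = "coefficient q x" and ?P = "real (\<Prod>M)"
  let ?K = "PiE M (\<lambda>p. {0..<int p})"
  let ?F = "\<lambda>k. \<Sum>S\<in>Pow M. ?c S * Re (\<Prod>p\<in>S. square_hat p (k p))"
  let ?e = "\<lambda>k. \<Sum>a\<in>A. \<Prod>p\<in>M. unity p (k p * a)"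
  have x0: "x \<ge> 0" by (simp add: x_def)
  have c0: "0 \<le> ?c S" for S using q x0 by (intro coefficient_nonneg) auto
  have x_small: "(1 + x) ^ l \<le> 2" if "l \<le> n" for l
  proof -
    have "(1 + x) ^ l \<le> (1 + x) ^ n" using x0 that by (intro power_increasing) auto
    also have "\<dots> \<le> exp x ^ n" using x0 by (intro power_mono) auto
    also have "\<dots> = exp (real n * x)" by (simp add: exp_of_nat_mult)
    also have "\<dots> \<le> exp (1 / 2)" by (simp add: x_def)
    also have "\<dots> \<le> 2" using exp_ge_add_one_self[of "- 1 / 2"] by (simp add: exp_minus field_simps)
    finally show ?thesis .
  qed
  have F_nonneg: "0 \<le> ?F k" if k: "k \<in> ?K" for k
  proof -
    let ?Z = "{p \<in> M. k p = 0}" and ?N = "{p \<in> M. k p \<noteq> 0}"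
    have N: "\<not> int p dvd k p" if "p \<in> ?N" for p
      using k that zdvd_not_zless[of "k p" "int p"] by (force simp: PiE_def Pi_def)
    have "0 \<le> (\<Sum>S\<in>Pow (?Z \<union> ?N). ?c S * Re (\<Prod>p\<in>S. square_hat p (k p)))"
    proof (rule sum_coefficient_nonneg[where g = "\<lambda>p. real (p - 1) / 2"])
      show "(1 + x) ^ card ?N \<le> 2"
        using fin by (intro x_small) (auto simp: n_def intro: card_mono)
    qed (use fin q x0 pos N prime square_hat_bounds_3_mod_4 square_hat_bounds_not_3_mod_4
        in \<open>auto simp: square_hat_0\<close>)
    moreover have "?Z \<union> ?N = M" by auto
    ultimately show ?thesis by simp
  qed
  define k0 where "k0 = (\<lambda>p\<in>M. 0 :: int)"
  have k0: "k0 \<in> ?K" using pos by (auto simp: k0_def)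
  have hat0: "(\<Prod>p\<in>S. square_hat p (k0 p)) = of_real (\<Prod>p\<in>S. real (p - 1) / 2)" if "S \<in> Pow M" for S
    unfolding of_real_prod using that
    by (intro prod.cong refl) (auto simp: k0_def square_hat_0 restrict_apply)
  have "?c M * (\<Prod>p\<in>M. real (p - 1) / 2) = ?c M * Re (\<Prod>p\<in>M. square_hat p (k0 p))"
    using hat0[of M] by (simp del: of_real_prod)
  also have "\<dots> \<le> ?F k0"
    using fin c0 by (intro member_le_sum) (auto simp: hat0 prod_nonneg simp del: of_real_prod)
  finally have F0: "?c M * (\<Prod>p\<in>M. real (p - 1) / 2) \<le> ?F k0" .
  \<comment> \<open>Equality at \<open>p = 2\<close> dictates the constant \<open>1/4\<close>.\<close>
  have "(\<Prod>p\<in>M. real p / 4) \<le> (\<Prod>p\<in>M. real (p - 1) / 2)"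
  proof (rule prod_mono)
    fix p assume "p \<in> M"
    then have "p \<ge> 2" using prime prime_ge_2_nat by blast
    then show "0 \<le> real p / 4 \<and> real p / 4 \<le> real (p - 1) / 2" by (simp add: of_nat_diff)
  qed
  then have "?c M * (?P / 4 ^ n) \<le> ?c M * (\<Prod>p\<in>M. real (p - 1) / 2)"
    using c0 by (intro mult_left_mono) (simp_all add: prod_dividef n_def)
  then have "?c M * (?P / 4 ^ n) * (real (card A))\<^sup>2 \<le> ?F k0 * (real (card A))\<^sup>2"
    using F0 by (intro mult_right_mono) auto
  also have "real (card A) = cmod (?e k0)"
    by (simp add: k0_def)
  also have "?F k0 * (cmod (?e k0))\<^sup>2 \<le> (\<Sum>k\<in>?K. ?F k * (cmod (?e k))\<^sup>2)"
    using fin k0 F_nonneg by (intro member_le_sum) (auto intro!: finite_PiE)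
  also have "\<dots> = (\<Sum>a\<in>A. \<Sum>b\<in>A. test_function M ?c (a - b)) * ?P"
    using sum_test_function_differences[OF fin pos] by simp
  also have "(\<Sum>a\<in>A. \<Sum>b\<in>A. test_function M ?c (a - b)) = (\<Sum>a\<in>A. \<Sum>b\<in>A. if a = b then 1 else 0)"
  proof (intro sum.cong refl)
    fix a b assume "a \<in> A" "b \<in> A"
    then show "test_function M ?c (a - b) = (if a = b then 1 else 0)"
      using test_function_nonzero_imp_square[OF fin(1) prime, of ?c "a - b"] avoid[of a b]
        test_function_0[OF fin(1) prime, of ?c]
      by (auto simp: coefficient_def parity_gain_def)
  qed
  also have "\<dots> = real (card A)" using fin by simp
  finally have "?c M * (?P / 4 ^ n) * (real (card A))\<^sup>2 \<le> real (card A) * ?P"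
    by (simp add: k0_def)
  moreover have P: "?P > 0" using pos by (auto intro!: prod_pos)
  ultimately have "(real (card A) * ?P) * (real (card A) * ?c M) \<le> (real (card A) * ?P) * 4 ^ n"
    by (simp add: field_simps power2_eq_square)
  then have bound: "real (card A) * ?c M \<le> 4 ^ n"
    using A P by (simp only: mult_le_cancel_left_pos mult_pos_pos)
  have sq: "(\<Prod>p\<in>M. sqrt (real p)) = sqrt ?P"
    using fin(1) by (induction M rule: finite_induct) (simp_all add: real_sqrt_mult)
  have inv: "x ^ n * (2 * real n) ^ n = 1"
    unfolding power_mult_distrib[symmetric] by (cases "n = 0") (simp_all add: x_def)
  have "real (card A) * parity_gain q M
      = (real (card A) * ?c M) * (sqrt ?P * (2 * real n) ^ n)"
    using inv P unfolding coefficient_def sq by (simp add: field_simps n_def)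
  also have "\<dots> \<le> 4 ^ n * (sqrt ?P * (2 * real n) ^ n)"
    using bound P by (intro mult_right_mono) auto
  also have "\<dots> = sqrt ?P * (8 * real n) ^ n"
  proof -
    have "(8 * real n) ^ n = (4 * (2 * real n)) ^ n" by simp
    also have "\<dots> = 4 ^ n * (2 * real n) ^ n" by (rule power_mult_distrib)
    finally show ?thesis by (simp only: mult_ac)
  qed
  finally show ?thesis by (simp add: n_def)
qed

lemma squarefree_eq_prod_primes:
  fixes m :: nat
  assumes "m > 0" "squarefree m"
  shows "m = \<Prod>{p. prime p \<and> p dvd m}"
proof -
  have "m = (\<Prod>p\<in>prime_factors m. p ^ multiplicity p m)"
    using assms by (simp add: prime_factorization_nat)
  also have "\<dots> = \<Prod>(prime_factors m)"
    using assms by (intro prod.cong) (auto simp: squarefree_factorial_semiring')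
  also have "prime_factors m = {p. prime p \<and> p dvd m}"
    using assms by (auto simp: prime_factors_dvd)
  finally show ?thesis .
qed

text \<open>
  Returns from the ring to congruences. The ring of integers modulo \<open>1\<close> is treated apart, as it falls
  outside the locale of residue rings; there the carrier has one element.
\<close>

lemma residue_ring_avoids_squares:
  fixes m :: nat
  defines "R \<equiv> residue_ring (int m)"
  assumes "m > 0" and A: "A \<subseteq> carrier R"
    and avoid: "difference_set R A \<inter> ring_squares R = {\<zero>\<^bsub>R\<^esub>}"
    and ab: "a \<in> A" "b \<in> A" and y: "[y\<^sup>2 = a - b] (mod int m)"
  shows "a = b"
proof -
  have range: "0 \<le> a" "a < int m" "0 \<le> b" "b < int m"
    using A ab by (auto simp: R_def residue_ring_def)
  show ?thesis
  proof (cases "m = 1")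
    case True
    then show ?thesis using range by simp
  next
    case False
    then interpret residues "int m" R
      using assms(2) by unfold_locales (simp_all add: R_def)
    let ?d = "(a - b) mod int m"
    have "a \<ominus>\<^bsub>R\<^esub> b = ?d"
      by (simp add: a_minus_def res_neg_eq res_add_eq mod_add_right_eq)
    then have "?d \<in> difference_set R A"
      using ab unfolding difference_set_def by force
    moreover have "?d = (y mod int m) \<otimes>\<^bsub>R\<^esub> (y mod int m)"
      using y by (simp add: res_mult_eq cong_def mod_mult_eq power2_eq_square)
    then have "?d \<in> ring_squares R"
      unfolding ring_squares_def using assms(2) by (force simp: res_carrier_eq)
    ultimately have "?d = 0" using avoid by (auto simp: res_zero_eq)
    then have "a mod int m = b mod int m" by (simp add: mod_eq_dvd_iff dvd_eq_mod_eq_0)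
    then show ?thesis using range by simp
  qed
qed

theorem theorem1p1:
  fixes m :: nat and A :: "int set"
  defines "R \<equiv> residue_ring (int m)"
  assumes "m > 0" and "squarefree m"
    and "A \<subseteq> carrier R"
    and "difference_set R A \<inter> ring_squares R = {\<zero>\<^bsub>R\<^esub>}"
  shows "real (card A) \<le>
    real m powr (1/2) * real (exceptional_factor m) powr (-1/2)
      * (10 * real (omega m)) ^ (2 * omega m)"
proof -
  let ?M = "{p. prime p \<and> p dvd m}" and ?M3 = "{p. prime p \<and> p dvd m \<and> p mod 4 = 3}"
  let ?q = "exceptional_factor m" and ?n = "omega m"
  have finM: "finite ?M" using assms(2) by simp
  have fin3: "finite ?M3" by (rule finite_subset[OF _ finM]) auto
  have finA: "finite A"
    using assms(4) by (rule finite_subset) (simp add: R_def residue_ring_def)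
  have m: "\<Prod>?M = m" using squarefree_eq_prod_primes[OF assms(2,3)] by simp
  have q: "1 \<le> real ?q \<and> (\<forall>p\<in>?M3. real ?q \<le> real p) \<and> parity_gain ?q ?M = sqrt ?q"
  proof (cases "odd (omega3 m)")
    case True
    then have "?M3 \<noteq> {}" unfolding omega3_def by (metis card.empty even_zero)
    then have "Min ?M3 \<in> ?M3" using fin3 by (rule Min_in[rotated])
    moreover have "{p \<in> ?M. p mod 4 = 3} = ?M3" by auto
    ultimately show ?thesis
      using True fin3 prime_ge_1_nat
      by (auto simp: exceptional_factor_def parity_gain_def omega3_def)
  next
    case False
    moreover have "{p \<in> ?M. p mod 4 = 3} = ?M3" by auto
    moreover have "1 \<le> p" if "p \<in> ?M3" for p using that prime_ge_1_nat by blast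
    ultimately show ?thesis
      by (auto simp: exceptional_factor_def parity_gain_def omega3_def)
  qed
  have "real (card A) * parity_gain ?q ?M \<le> sqrt (real (\<Prod>?M)) * (8 * real (card ?M)) ^ card ?M"
  proof (rule card_le_of_differences_avoid_squares[OF finM finA])
    fix a b y assume "a \<in> A" "b \<in> A" "[y\<^sup>2 = a - b] (mod int (\<Prod>?M))"
    then show "a = b"
      using residue_ring_avoids_squares[of m A a b y] assms unfolding m by simp
  qed (use q in auto)
  then have main: "real (card A) * sqrt ?q \<le> sqrt m * (8 * real ?n) ^ ?n"
    using q by (simp add: m omega_def)
  have "(8 * real ?n) ^ ?n \<le> (10 * real ?n) ^ (2 * ?n)"
  proof (cases "?n = 0")
    case False
    have "(8 * real ?n) ^ ?n \<le> (10 * real ?n) ^ ?n" by (intro power_mono) auto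
    also have "\<dots> \<le> (10 * real ?n) ^ (2 * ?n)" using False by (intro power_increasing) auto
    finally show ?thesis .
  qed simp
  then have "real (card A) * sqrt ?q \<le> sqrt m * (10 * real ?n) ^ (2 * ?n)"
    using main by (meson mult_left_mono order_trans real_sqrt_ge_zero of_nat_0_le_iff)
  moreover have "real ?q > 0" using q by linarith
  ultimately have "real (card A) \<le> sqrt m * (1 / sqrt ?q) * (10 * real ?n) ^ (2 * ?n)"
    by (simp add: field_simps)
  also have "1 / sqrt ?q = real ?q powr (-1/2)"
    using powr_minus_divide[of "real ?q" "1/2"] by (simp add: powr_half_sqrt)
  finally show ?thesis
    by (simp only: powr_half_sqrt of_nat_0_le_iff)
qed

end
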